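(* Let $n>3$ and let $G_{150}$ be the dynamics group of Wolfram rule $150$ on the circular graph with $n$ vertices. When $n$ is odd, $G_{150}$ is isomorphic to $(\mathbb{Z}_2^n\perp\mathbf{1})\rtimes\mathrm{Sym}_n$, and when $n$ is even, $G_{150}$ is isomorphic to $\left((\mathbb{Z}_2^n\perp\mathbf{1})/\langle\mathbf{1}\rangle\right)\rtimes\mathrm{Sym}_n$. In particular, $|G_{150}|=2^{n-1}\cdot n!$ when $2\nmid n$ and $|G_{150}|=2^{n-2}\cdot n!$ when $2\mid n$.
   Context: Indices are taken modulo $n$. For $1\le i\le n$ let $F_i\colon\mathbb{F}_2^n\to\mathbb{F}_2^n$ (the local update function of Wolfram rule $150$) be the map that replaces $y_i$ by $y_{i-1}+y_i+y_{i+1}\bmod 2$ and leaves all other coordinates unchanged. Each $F_i$ is a bijection, every state in $\mathbb{F}_2^n$ is periodic, and the dynamics group $G_{150}$ is the group of permutations of $\mathbb{F}_2^n$ generated by $F_1,\dots,F_n$. $\mathbb{Z}_2=\mathbb{Z}/2\mathbb{Z}$, $\mathbf{1}=(1,1,\dots,1)$, and $(\mathbb{Z}_2^n\perp\mathbf{1})$ is the additive group of vectors in $\mathbb{Z}_2^n$ whose coordinates sum to $0$. The symmetric group $\mathrm{Sym}_n$ acts on $(\mathbb{Z}_2^n\perp\mathbf{1})$ by permuting coordinates, and (when $n$ is even, so that $\mathbf{1}\in(\mathbb{Z}_2^n\perp\mathbf{1})$) on the quotient $(\mathbb{Z}_2^n\perp\mathbf{1})/\langle\mathbf{1}\rangle$;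 the semidirect products are with respect to these actions. *)

theory Defs
  imports "HOL-Algebra.Algebra"
begin

section \<open>The dynamics group of Wolfram rule 150\<close>

definition Z2_power :: "nat \<Rightarrow> (nat \<Rightarrow> int) monoid"
  where "Z2_power n = product_group {1..n} (\<lambda>_. integer_mod_group 2)"

definition pred_vertex :: "nat \<Rightarrow> nat \<Rightarrow> nat"
  where "pred_vertex n i = (if i = 1 then n else i - 1)"

definition succ_vertex :: "nat \<Rightarrow> nat \<Rightarrow> nat"
  where "succ_vertex n i = (if i = n then 1 else i + 1)"

text \<open>States are the elements of \<^term>\<open>carrier (Z2_power n)\<close>; as elements of
  \<^const>\<open>BijGroup\<close> are extensional functions, the update is restricted to states.\<close>

definition rule150_update :: "nat \<Rightarrow> nat \<Rightarrow> (nat \<Rightarrow> int) \<Rightarrow> (nat \<Rightarrow> int)"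
  where "rule150_update n i =
    (\<lambda>y \<in> carrier (Z2_power n).
       y(i := (y (pred_vertex n i) + y i + y (succ_vertex n i)) mod 2))"

definition G150 :: "nat \<Rightarrow> ((nat \<Rightarrow> int) \<Rightarrow> (nat \<Rightarrow> int)) monoid"
  where "G150 n =
    (BijGroup (carrier (Z2_power n)))
      \<lparr>carrier := generate (BijGroup (carrier (Z2_power n))) (rule150_update n ` {1..n})\<rparr>"

section \<open>Semidirect products\<close>

text \<open>The intended use is with \<open>\<phi> \<in> hom H (AutoGroup N)\<close>; this is proved below
  for the two actions that are used.\<close>

definition semidirect_product ::
    "('a, 'c) monoid_scheme \<Rightarrow> ('b, 'd) monoid_scheme \<Rightarrow> ('b \<Rightarrow> 'a \<Rightarrow> 'a) \<Rightarrow> ('a \<times> 'b) monoid"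
  where "semidirect_product N H \<phi> =
    \<lparr>carrier = carrier N \<times> carrier H,
     monoid.mult = (\<lambda>(v, g) (w, h). (v \<otimes>\<^bsub>N\<^esub> \<phi> g w, g \<otimes>\<^bsub>H\<^esub> h)),
     one = (\<one>\<^bsub>N\<^esub>, \<one>\<^bsub>H\<^esub>)\<rparr>"

section \<open>Coordinate permutation actions\<close>

definition all_ones :: "nat \<Rightarrow> nat \<Rightarrow> int"
  where "all_ones n = (\<lambda>i \<in> {1..n}. 1)"

definition perp_ones :: "nat \<Rightarrow> (nat \<Rightarrow> int) monoid"
  where "perp_ones n =
    (Z2_power n) \<lparr>carrier := {v \<in> carrier (Z2_power n). (\<Sum>i = 1..n. v i) mod 2 = 0}\<rparr>"

definition perp_ones_quot :: "nat \<Rightarrow> (nat \<Rightarrow> int) set monoid"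
  where "perp_ones_quot n = perp_ones n Mod generate (perp_ones n) {all_ones n}"

text \<open>The inverse makes this a left action: the entry at \<open>i\<close> is moved to \<open>\<sigma> i\<close>.\<close>

definition permute_coords :: "nat \<Rightarrow> (nat \<Rightarrow> nat) \<Rightarrow> (nat \<Rightarrow> int) \<Rightarrow> (nat \<Rightarrow> int)"
  where "permute_coords n \<sigma> = (\<lambda>v \<in> carrier (perp_ones n). \<lambda>i \<in> {1..n}. v (inv' \<sigma> i))"

definition permute_coords_quot ::
    "nat \<Rightarrow> (nat \<Rightarrow> nat) \<Rightarrow> (nat \<Rightarrow> int) set \<Rightarrow> (nat \<Rightarrow> int) set"
  where "permute_coords_quot n \<sigma> = (\<lambda>A \<in> carrier (perp_ones_quot n). permute_coords n \<sigma> ` A)"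

section \<open>Well-formedness of the definitions\<close>

lemma carrier_Z2_power: "carrier (Z2_power n) = {1..n} \<rightarrow>\<^sub>E {0..<2}"
  by (simp add: Z2_power_def carrier_integer_mod_group)

lemma mult_Z2_power: "v \<otimes>\<^bsub>Z2_power n\<^esub> w = (\<lambda>i\<in>{1..n}. (v i + w i) mod 2)"
  by (simp add: Z2_power_def)

lemma group_Z2_power: "group (Z2_power n)"
  by (simp add: Z2_power_def)

lemma rule150_update_closed:
  assumes "i \<in> {1..n}" "y \<in> carrier (Z2_power n)"
  shows "rule150_update n i y \<in> carrier (Z2_power n)"
  using assms by (auto simp: rule150_update_def carrier_Z2_power PiE_iff extensional_def)

lemma rule150_update_involution:
  assumes n: "n > 3" and i: "i \<in> {1..n}" and y: "y \<in> carrier (Z2_power n)"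
  shows "rule150_update n i (rule150_update n i y) = y"
proof -
  have ne: "pred_vertex n i \<noteq> i" "succ_vertex n i \<noteq> i"
    using n i by (auto simp: pred_vertex_def succ_vertex_def)
  have yi: "0 \<le> y i" "y i < 2"
    using y i by (auto simp: carrier_Z2_power PiE_iff)
  have "(p + (p + q + s) mod 2 + s) mod 2 = q" if "0 \<le> q" "q < 2" for p q s :: int
  proof -
    have "(p + (p + q + s) mod 2 + s) mod 2 = (p + (p + q + s) + s) mod 2"
      by (metis mod_add_left_eq mod_add_right_eq)
    also have "p + (p + q + s) + s = q + 2 * (p + s)" by simp
    also have "(q + 2 * (p + s)) mod 2 = q mod 2" by (rule mod_mult_self2)
    finally show ?thesis using that by simp
  qed
  then show ?thesis
    using rule150_update_closed[OF i y] y ne yi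
    by (simp add: rule150_update_def)
qed

lemma rule150_update_in_BijGroup:
  assumes "n > 3" "i \<in> {1..n}"
  shows "rule150_update n i \<in> carrier (BijGroup (carrier (Z2_power n)))"
proof -
  have "bij_betw (rule150_update n i) (carrier (Z2_power n)) (carrier (Z2_power n))"
    by (rule bij_betw_byWitness[where f' = "rule150_update n i"])
       (auto simp: rule150_update_involution[OF assms] rule150_update_closed[OF assms(2)])
  moreover have "rule150_update n i \<in> extensional (carrier (Z2_power n))"
    by (simp add: rule150_update_def)
  ultimately show ?thesis
    by (simp add: BijGroup_def Bij_def)
qed

lemma group_G150: "n > 3 \<Longrightarrow> group (G150 n)"
  unfolding G150_def
  by (intro subgroup.subgroup_is_group group.generate_is_subgroup group_BijGroup)
     (auto intro: rule150_update_in_BijGroup)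

lemma hom_AutoGroupI:
  assumes G: "group H"
    and ext: "\<And>g. g \<in> carrier H \<Longrightarrow> \<phi> g \<in> extensional (carrier N)"
    and hom: "\<And>g. g \<in> carrier H \<Longrightarrow> \<phi> g \<in> hom N N"
    and one: "\<And>x. x \<in> carrier N \<Longrightarrow> \<phi> \<one>\<^bsub>H\<^esub> x = x"
    and mult: "\<And>g h x. g \<in> carrier H \<Longrightarrow> h \<in> carrier H \<Longrightarrow> x \<in> carrier N \<Longrightarrow>
                 \<phi> (g \<otimes>\<^bsub>H\<^esub> h) x = \<phi> g (\<phi> h x)"
  shows "\<phi> \<in> hom H (AutoGroup N)"
proof -
  interpret H: group H by fact
  have closed: "\<phi> g x \<in> carrier N" if "g \<in> carrier H" "x \<in> carrier N" for g x
    using hom that by (auto simp: hom_def)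
  have inverse: "\<phi> (inv\<^bsub>H\<^esub> g) (\<phi> g x) = x" "\<phi> g (\<phi> (inv\<^bsub>H\<^esub> g) x) = x"
    if "g \<in> carrier H" "x \<in> carrier N" for g x
    using that mult[of "inv\<^bsub>H\<^esub> g" g x] mult[of g "inv\<^bsub>H\<^esub> g" x] by (simp_all add: one)
  have Bij: "\<phi> g \<in> Bij (carrier N)" if g: "g \<in> carrier H" for g
  proof -
    have "bij_betw (\<phi> g) (carrier N) (carrier N)"
      by (rule bij_betw_byWitness[where f' = "\<phi> (inv\<^bsub>H\<^esub> g)"])
         (auto simp: inverse closed g)
    then show ?thesis
      using ext g by (simp add: Bij_def)
  qed
  have "\<phi> (g \<otimes>\<^bsub>H\<^esub> h) = compose (carrier N) (\<phi> g) (\<phi> h)"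
    if "g \<in> carrier H" "h \<in> carrier H" for g h
    by (rule extensionalityI[OF ext compose_extensional]) (auto simp: that mult compose_eq)
  then show ?thesis
    using Bij hom by (auto simp: hom_def[of H] AutoGroup_def BijGroup_def auto_def)
qed

lemma carrier_perp_ones:
  "carrier (perp_ones n) = {v \<in> carrier (Z2_power n). (\<Sum>i = 1..n. v i) mod 2 = 0}"
  by (simp add: perp_ones_def)

lemma mult_perp_ones: "v \<otimes>\<^bsub>perp_ones n\<^esub> w = (\<lambda>i\<in>{1..n}. (v i + w i) mod 2)"
  by (simp add: perp_ones_def mult_Z2_power)

lemma subgroup_perp_ones: "subgroup (carrier (perp_ones n)) (Z2_power n)"
proof (rule group.subgroupI[OF group_Z2_power])
  show "carrier (perp_ones n) \<subseteq> carrier (Z2_power n)"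
    by (auto simp: carrier_perp_ones)
  have "\<one>\<^bsub>Z2_power n\<^esub> \<in> carrier (perp_ones n)"
    by (auto simp: carrier_perp_ones Z2_power_def carrier_integer_mod_group)
  then show "carrier (perp_ones n) \<noteq> {}" by blast
next
  fix a assume a: "a \<in> carrier (perp_ones n)"
  then have ext: "a \<in> extensional {1..n}" and range: "\<And>i. i \<in> {1..n} \<Longrightarrow> 0 \<le> a i \<and> a i < 2"
    by (auto simp: carrier_perp_ones carrier_Z2_power PiE_iff)
  have neg: "(- x) mod 2 = x" if "0 \<le> x \<and> x < 2" for x :: int
    using that by presburger
  have "inv\<^bsub>Z2_power n\<^esub> a = (\<lambda>i\<in>{1..n}. inv\<^bsub>integer_mod_group 2\<^esub> (a i))"
    using a unfolding carrier_perp_ones Z2_power_def by (intro inv_product_group) auto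
  also have "\<dots> = a"
    by (rule extensionalityI[OF _ ext]) (use range in \<open>auto simp: carrier_integer_mod_group neg\<close>)
  finally show "inv\<^bsub>Z2_power n\<^esub> a \<in> carrier (perp_ones n)"
    using a by simp
next
  fix a b assume "a \<in> carrier (perp_ones n)" "b \<in> carrier (perp_ones n)"
  then have "even (\<Sum>i = 1..n. a i)" "even (\<Sum>i = 1..n. b i)"
    by (simp_all add: carrier_perp_ones even_iff_mod_2_eq_zero)
  then have "(\<Sum>i = 1..n. a i + b i) mod 2 = 0"
    by (simp add: sum.distrib flip: even_iff_mod_2_eq_zero)
  then have "(\<Sum>i = 1..n. (a i + b i) mod 2) mod 2 = 0"
    by (simp only: mod_sum_eq)
  then show "a \<otimes>\<^bsub>Z2_power n\<^esub> b \<in> carrier (perp_ones n)"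
    by (simp add: carrier_perp_ones mult_Z2_power carrier_Z2_power)
qed

lemma comm_group_perp_ones: "comm_group (perp_ones n)"
proof -
  have "group (perp_ones n)"
    using subgroup.subgroup_is_group[OF subgroup_perp_ones group_Z2_power, of n]
    by (simp add: perp_ones_def)
  then show ?thesis
    by (intro group.group_comm_groupI) (auto simp: mult_perp_ones add.commute)
qed

lemma all_ones_in_perp_ones: "even n \<Longrightarrow> all_ones n \<in> carrier (perp_ones n)"
  by (auto simp: all_ones_def carrier_perp_ones carrier_Z2_power)

lemma permute_coords_hom:
  assumes "\<sigma> permutes {1..n}"
  shows "permute_coords n \<sigma> \<in> hom (perp_ones n) (perp_ones n)"
proof -
  have inv: "inv' \<sigma> permutes {1..n}" using assms by (rule permutes_inv)
  have mem: "inv' \<sigma> i \<in> {1..n}" if "i \<in> {1..n}" for i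
    using permutes_in_image[OF inv] that by blast
  have closed: "permute_coords n \<sigma> v \<in> carrier (perp_ones n)"
    if v: "v \<in> carrier (perp_ones n)" for v
  proof -
    have "(\<Sum>i = 1..n. v (inv' \<sigma> i)) = (\<Sum>i = 1..n. v i)"
      using sum.permute[OF inv, of v] by (simp add: o_def)
    then show ?thesis
      using v mem by (auto simp: permute_coords_def carrier_perp_ones carrier_Z2_power PiE_iff)
  qed
  interpret comm_group "perp_ones n" by (rule comm_group_perp_ones)
  show ?thesis
  proof (rule homI)
    fix v w assume vw: "v \<in> carrier (perp_ones n)" "w \<in> carrier (perp_ones n)"
    then show "permute_coords n \<sigma> (v \<otimes>\<^bsub>perp_ones n\<^esub> w)
        = permute_coords n \<sigma> v \<otimes>\<^bsub>perp_ones n\<^esub> permute_coords n \<sigma> w"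
      using m_closed[OF vw] mem
      by (auto simp: permute_coords_def mult_perp_ones intro!: restrict_ext)
  qed (rule closed)
qed

lemma permute_coords_closed:
  "\<sigma> permutes {1..n} \<Longrightarrow> v \<in> carrier (perp_ones n) \<Longrightarrow> permute_coords n \<sigma> v \<in> carrier (perp_ones n)"
  by (rule hom_in_carrier[OF permute_coords_hom])

lemma permute_coords_compose:
  assumes g: "g permutes {1..n}" and h: "h permutes {1..n}" and v: "v \<in> carrier (perp_ones n)"
  shows "permute_coords n (g \<circ> h) v = permute_coords n g (permute_coords n h v)"
proof -
  have "inv' (g \<circ> h) = inv' h \<circ> inv' g"
    using g h by (intro o_inv_distrib permutes_bij)
  moreover have "inv' g i \<in> {1..n}" if "i \<in> {1..n}" for i
    using permutes_in_image[OF permutes_inv[OF g]] that by blast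
  moreover have "permute_coords n h v \<in> carrier (perp_ones n)"
    using h v by (rule permute_coords_closed)
  ultimately show ?thesis
    using v by (simp add: permute_coords_def cong: restrict_cong)
qed

lemma permute_coords_id:
  assumes "v \<in> carrier (perp_ones n)"
  shows "permute_coords n id v = v"
proof -
  have "v \<in> extensional {1..n}"
    using assms by (simp add: carrier_perp_ones carrier_Z2_power PiE_iff)
  then show ?thesis
    using assms by (simp del: One_nat_def add: permute_coords_def extensional_restrict)
qed

lemma permute_coords_action: "permute_coords n \<in> hom (sym_group n) (AutoGroup (perp_ones n))"
  by (rule hom_AutoGroupI[OF sym_group_is_group])
     (simp_all del: One_nat_def add: permute_coords_hom permute_coords_compose permute_coords_id
        sym_group_carrier sym_group_one sym_group_mult, simp add: permute_coords_def)

lemma normal_generate_all_ones: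
  assumes "even n"
  shows "normal (generate (perp_ones n) {all_ones n}) (perp_ones n)"
proof -
  interpret comm_group "perp_ones n" by (rule comm_group_perp_ones)
  show ?thesis
    by (intro subgroup_imp_normal generate_is_subgroup)
       (simp add: all_ones_in_perp_ones assms)
qed

lemma permute_coords_image_rcoset:
  assumes n: "even n" and \<sigma>: "\<sigma> permutes {1..n}" and v: "v \<in> carrier (perp_ones n)"
  defines "K \<equiv> generate (perp_ones n) {all_ones n}"
  shows "permute_coords n \<sigma> ` (K #>\<^bsub>perp_ones n\<^esub> v) = K #>\<^bsub>perp_ones n\<^esub> permute_coords n \<sigma> v"
proof -
  interpret comm_group "perp_ones n" by (rule comm_group_perp_ones)
  interpret h: group_hom "perp_ones n" "perp_ones n" "permute_coords n \<sigma>"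
    by unfold_locales (rule permute_coords_hom[OF \<sigma>])
  have ones: "all_ones n \<in> carrier (perp_ones n)"
    using n by (rule all_ones_in_perp_ones)
  have "inv' \<sigma> i \<in> {1..n}" if "i \<in> {1..n}" for i
    using permutes_in_image[OF permutes_inv[OF \<sigma>]] that by blast
  then have "permute_coords n \<sigma> (all_ones n) = all_ones n"
    using ones by (auto simp: permute_coords_def all_ones_def intro!: restrict_ext)
  then have K: "permute_coords n \<sigma> ` K = K"
    using h.generate_img[of "{all_ones n}"] ones by (simp add: K_def)
  have sub: "K \<subseteq> carrier (perp_ones n)"
    unfolding K_def using ones by (intro generate_incl) simp
  have "permute_coords n \<sigma> ` (K #>\<^bsub>perp_ones n\<^esub> v)
      = (\<lambda>k. permute_coords n \<sigma> (k \<otimes>\<^bsub>perp_ones n\<^esub> v)) ` K"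
    unfolding r_coset_def by blast
  also have "\<dots> = (\<lambda>k. permute_coords n \<sigma> k \<otimes>\<^bsub>perp_ones n\<^esub> permute_coords n \<sigma> v) ` K"
    using sub v by (intro image_cong refl h.hom_mult) auto
  also have "\<dots> = (permute_coords n \<sigma> ` K) #>\<^bsub>perp_ones n\<^esub> permute_coords n \<sigma> v"
    unfolding r_coset_def by blast
  finally show ?thesis by (simp only: K)
qed

lemma permute_coords_quot_action:
  assumes n: "even n"
  shows "permute_coords_quot n \<in> hom (sym_group n) (AutoGroup (perp_ones_quot n))"
proof (rule hom_AutoGroupI[OF sym_group_is_group])
  let ?K = "generate (perp_ones n) {all_ones n}"
  let ?P = "perp_ones n"
  interpret comm_group ?P by (rule comm_group_perp_ones)
  interpret K: normal ?K ?P using n by (rule normal_generate_all_ones)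
  have coset: "\<exists>v \<in> carrier ?P. A = ?K #>\<^bsub>?P\<^esub> v" if "A \<in> carrier (perp_ones_quot n)" for A
    using that by (auto simp: perp_ones_quot_def carrier_FactGroup)
  have in_quot: "?K #>\<^bsub>?P\<^esub> v \<in> carrier (perp_ones_quot n)" if "v \<in> carrier ?P" for v
    using that by (auto simp: perp_ones_quot_def carrier_FactGroup)
  have on_coset: "permute_coords_quot n g (?K #>\<^bsub>?P\<^esub> v) = ?K #>\<^bsub>?P\<^esub> permute_coords n g v"
    if "g permutes {1..n}" "v \<in> carrier ?P" for g v
    using that by (simp add: permute_coords_quot_def in_quot permute_coords_image_rcoset n)
  {
    fix g assume "g \<in> carrier (sym_group n)"
    then show "permute_coords_quot n g \<in> extensional (carrier (perp_ones_quot n))"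
      by (simp add: permute_coords_quot_def)
  next
    fix g assume "g \<in> carrier (sym_group n)"
    then have g: "g permutes {1..n}" by (simp add: sym_group_carrier)
    show "permute_coords_quot n g \<in> hom (perp_ones_quot n) (perp_ones_quot n)"
    proof (rule homI)
      fix A assume "A \<in> carrier (perp_ones_quot n)"
      then obtain v where "v \<in> carrier ?P" "A = ?K #>\<^bsub>?P\<^esub> v" using coset by blast
      then show "permute_coords_quot n g A \<in> carrier (perp_ones_quot n)"
        by (simp add: on_coset[OF g] in_quot permute_coords_closed[OF g])
    next
      fix A B assume "A \<in> carrier (perp_ones_quot n)" "B \<in> carrier (perp_ones_quot n)"
      then obtain v w where v: "v \<in> carrier ?P" "A = ?K #>\<^bsub>?P\<^esub> v"
        and w: "w \<in> carrier ?P" "B = ?K #>\<^bsub>?P\<^esub> w" using coset by meson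
      have mult: "(?K #>\<^bsub>?P\<^esub> a) \<otimes>\<^bsub>perp_ones_quot n\<^esub> (?K #>\<^bsub>?P\<^esub> b) = ?K #>\<^bsub>?P\<^esub> (a \<otimes>\<^bsub>?P\<^esub> b)"
        if "a \<in> carrier ?P" "b \<in> carrier ?P" for a b
        using that by (simp add: perp_ones_quot_def K.rcos_sum)
      show "permute_coords_quot n g (A \<otimes>\<^bsub>perp_ones_quot n\<^esub> B)
          = permute_coords_quot n g A \<otimes>\<^bsub>perp_ones_quot n\<^esub> permute_coords_quot n g B"
        using v w by (simp add: mult on_coset[OF g] permute_coords_closed[OF g]
            hom_mult[OF permute_coords_hom[OF g]])
    qed
  next
    fix A assume "A \<in> carrier (perp_ones_quot n)"
    then obtain v where v: "v \<in> carrier ?P" "A = ?K #>\<^bsub>?P\<^esub> v" using coset by blast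
    then show "permute_coords_quot n \<one>\<^bsub>sym_group n\<^esub> A = A"
      by (simp del: One_nat_def add: on_coset sym_group_one permutes_id permute_coords_id)
  next
    fix g h A
    assume g: "g \<in> carrier (sym_group n)" and h: "h \<in> carrier (sym_group n)"
      and "A \<in> carrier (perp_ones_quot n)"
    then obtain v where v: "v \<in> carrier ?P" "A = ?K #>\<^bsub>?P\<^esub> v" using coset by blast
    have "g permutes {1..n}" "h permutes {1..n}" "g \<circ> h permutes {1..n}"
      using g h by (simp_all add: sym_group_carrier permutes_compose)
    then show "permute_coords_quot n (g \<otimes>\<^bsub>sym_group n\<^esub> h) A
        = permute_coords_quot n g (permute_coords_quot n h A)"
      using v by (simp del: One_nat_def
          add: on_coset permute_coords_compose permute_coords_closed sym_group_mult)
  }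
qed

end

theory Submission
  imports Defs
begin

text \<open>
  The idea is to describe a state \<open>y\<close> on the cycle by its value \<open>y 1\<close> and its differences
  \<open>d\<^sub>j = y\<^sub>j + y\<^sub>j\<^sub>+\<^sub>1\<close>, which form a vector of even weight.  Replacing \<open>y\<^sub>i\<close> by
  \<open>y\<^sub>i\<^sub>-\<^sub>1 + y\<^sub>i + y\<^sub>i\<^sub>+\<^sub>1\<close> exchanges \<open>d\<^sub>i\<^sub>-\<^sub>1\<close> and \<open>d\<^sub>i\<close> and leaves the other differences alone
  (\<open>differences_rule150_update\<close>); the value \<open>y 1\<close> changes only for \<open>i = 1\<close>, and then by
  \<open>d\<^sub>n + d\<^sub>1\<close>.

  Accordingly, the semidirect product of the even-weight vectors \<open>v\<close> and the permutations
  \<open>\<sigma>\<close> acts on pairs \<open>(b, d)\<close> by \<open>(b, d) \<mapsto> (b + v \<bullet> \<sigma>d, \<sigma>d)\<close>.  The update at \<open>i \<noteq> 1\<close> is the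
  action of \<open>(0, (i-1 i))\<close>, and the update at \<open>1\<close> is the action of \<open>(e\<^sub>1 + e\<^sub>n, (n 1))\<close>
  (\<open>state_action_rule150_element\<close>).  These elements generate the whole semidirect product
  (\<open>generate_rule150_elements\<close>): the adjacent transpositions give all permutations, so
  \<open>e\<^sub>1 + e\<^sub>n\<close> and its conjugates \<open>e\<^sub>i + e\<^sub>j\<close> are reached, and these span the even-weight
  vectors.  Hence the semidirect product maps onto the dynamics group.

  A pair \<open>(v, \<sigma>)\<close> acts trivially exactly if \<open>\<sigma>\<close> fixes all even-weight vectors, which forces
  \<open>\<sigma> = id\<close>, and \<open>v\<close> is orthogonal to all of them, which forces \<open>v\<close> to be \<open>0\<close> or the all-ones
  vector (\<open>kernel_state_action\<close>).  For odd \<open>n\<close> the all-ones vector has odd weight and the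
  kernel is trivial; for even \<open>n\<close> the kernel is the one that the quotient by
  the all-ones vector removes (\<open>affine_proj_onto\<close>).  The orders follow, since the
  description of states by pairs shows that half of all vectors have even weight.
\<close>

section \<open>Group-theoretic preliminaries\<close>

(* Keeps 1 in this form, so that intervals {1..n} match the given facts about them. *)
declare One_nat_def [simp del]

lemma group_semidirect_product:
  assumes N: "group N" and H: "group H" and \<phi>: "\<phi> \<in> hom H (AutoGroup N)"
  shows "group (semidirect_product N H \<phi>)"
proof -
  interpret N: group N by fact
  interpret H: group H by fact
  have auto: "\<phi> g \<in> auto N" if "g \<in> carrier H" for g
    using hom_in_carrier[OF \<phi> that] by (simp add: AutoGroup_def)
  have hom: "\<phi> g \<in> hom N N" if "g \<in> carrier H" for g
    using auto[OF that] by (simp add: auto_def)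
  have closed: "\<phi> g x \<in> carrier N" if "g \<in> carrier H" "x \<in> carrier N" for g x
    using hom_in_carrier[OF hom] that by blast
  have comp: "\<phi> (g \<otimes>\<^bsub>H\<^esub> h) x = \<phi> g (\<phi> h x)"
    if "g \<in> carrier H" "h \<in> carrier H" "x \<in> carrier N" for g h x
  proof -
    have "\<phi> g \<in> Bij (carrier N)" "\<phi> h \<in> Bij (carrier N)"
      using auto that by (auto simp: auto_def)
    then show ?thesis
      using hom_mult[OF \<phi> that(1,2)] that(3)
      by (simp add: AutoGroup_def BijGroup_def compose_eq)
  qed
  have one: "\<phi> \<one>\<^bsub>H\<^esub> x = x" if "x \<in> carrier N" for x
  proof -
    have "\<phi> \<one>\<^bsub>H\<^esub> = \<one>\<^bsub>AutoGroup N\<^esub>"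
      using group_hom.hom_one[of H "AutoGroup N" \<phi>] N.AutoGroup H \<phi>
      by (simp add: group_hom_def group_hom_axioms_def)
    then show ?thesis using that by (simp add: AutoGroup_def BijGroup_def)
  qed
  have mult: "\<phi> g (x \<otimes>\<^bsub>N\<^esub> y) = \<phi> g x \<otimes>\<^bsub>N\<^esub> \<phi> g y"
    if "g \<in> carrier H" "x \<in> carrier N" "y \<in> carrier N" for g x y
    using hom_mult[OF hom] that by blast
  show ?thesis
  proof (rule groupI)
    fix p assume "p \<in> carrier (semidirect_product N H \<phi>)"
    then obtain v g where p: "p = (v, g)" "v \<in> carrier N" "g \<in> carrier H"
      by (auto simp: semidirect_product_def)
    then have "(\<phi> (inv\<^bsub>H\<^esub> g) (inv\<^bsub>N\<^esub> v), inv\<^bsub>H\<^esub> g) \<otimes>\<^bsub>semidirect_product N H \<phi>\<^esub> p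
        = \<one>\<^bsub>semidirect_product N H \<phi>\<^esub>"
      using mult[of "inv\<^bsub>H\<^esub> g" "inv\<^bsub>N\<^esub> v" v] mult[of "inv\<^bsub>H\<^esub> g" "\<one>\<^bsub>N\<^esub>" "\<one>\<^bsub>N\<^esub>"]
      by (simp add: semidirect_product_def closed)
    moreover have "(\<phi> (inv\<^bsub>H\<^esub> g) (inv\<^bsub>N\<^esub> v), inv\<^bsub>H\<^esub> g) \<in> carrier (semidirect_product N H \<phi>)"
      using p by (simp add: semidirect_product_def closed)
    ultimately show "\<exists>q\<in>carrier (semidirect_product N H \<phi>).
        q \<otimes>\<^bsub>semidirect_product N H \<phi>\<^esub> p = \<one>\<^bsub>semidirect_product N H \<phi>\<^esub>" by blast
  qed (auto simp: semidirect_product_def closed comp one mult N.m_assoc H.m_assoc)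
qed

lemma hom_BijGroupI:
  assumes H: "group H"
    and ext: "\<And>g. g \<in> carrier H \<Longrightarrow> \<phi> g \<in> extensional S"
    and closed: "\<And>g x. g \<in> carrier H \<Longrightarrow> x \<in> S \<Longrightarrow> \<phi> g x \<in> S"
    and one: "\<And>x. x \<in> S \<Longrightarrow> \<phi> \<one>\<^bsub>H\<^esub> x = x"
    and mult: "\<And>g h x. g \<in> carrier H \<Longrightarrow> h \<in> carrier H \<Longrightarrow> x \<in> S \<Longrightarrow>
                 \<phi> (g \<otimes>\<^bsub>H\<^esub> h) x = \<phi> g (\<phi> h x)"
  shows "\<phi> \<in> hom H (BijGroup S)"
proof -
  interpret H: group H by fact
  have inverse: "\<phi> (inv\<^bsub>H\<^esub> g) (\<phi> g x) = x" "\<phi> g (\<phi> (inv\<^bsub>H\<^esub> g) x) = x"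
    if "g \<in> carrier H" "x \<in> S" for g x
    using that mult[of "inv\<^bsub>H\<^esub> g" g x] mult[of g "inv\<^bsub>H\<^esub> g" x] by (simp_all add: one)
  have Bij: "\<phi> g \<in> Bij S" if g: "g \<in> carrier H" for g
  proof -
    have "bij_betw (\<phi> g) S S"
      by (rule bij_betw_byWitness[where f' = "\<phi> (inv\<^bsub>H\<^esub> g)"]) (auto simp: inverse closed g)
    then show ?thesis using ext g by (simp add: Bij_def)
  qed
  have "\<phi> (g \<otimes>\<^bsub>H\<^esub> h) = compose S (\<phi> g) (\<phi> h)"
    if "g \<in> carrier H" "h \<in> carrier H" for g h
    by (rule extensionalityI[OF ext compose_extensional]) (auto simp: that mult compose_eq)
  then show ?thesis
    using Bij by (auto simp: hom_def BijGroup_def)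
qed

text \<open>By the first isomorphism theorem both images are the quotient of \<open>G\<close> by the common
  kernel.  This allows the dynamics group to be compared with a semidirect product
  without choosing coset representatives.\<close>

lemma iso_of_equal_kernels:
  assumes f: "group_hom G H f" and g: "group_hom G L g"
    and "f ` carrier G = carrier H" "g ` carrier G = carrier L"
    and "kernel G H f = kernel G L g"
  shows "H \<cong> L"
proof -
  have "G Mod kernel G H f \<cong> H" "G Mod kernel G L g \<cong> L"
    using assms group_hom.FactGroup_iso by blast+
  moreover have "group (G Mod kernel G H f)"
    using normal.factorgroup_is_group group_hom.normal_kernel f by blast
  ultimately show ?thesis
    using assms(5) group.iso_sym iso_trans by metis
qed

section \<open>Difference coordinates\<close>

lemma perp_ones_iff:
  "v \<in> carrier (perp_ones n) \<longleftrightarrow>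
    v \<in> extensional {1..n} \<and> (\<forall>i\<in>{1..n}. v i = 0 \<or> v i = 1) \<and> even (\<Sum>i = 1..n. v i)"
proof -
  have "v i \<in> {0..<2} \<longleftrightarrow> v i = 0 \<or> v i = 1" for i by auto
  then show ?thesis
    by (auto simp: carrier_perp_ones carrier_Z2_power PiE_iff even_iff_mod_2_eq_zero)
qed

lemma state_iff:
  "y \<in> carrier (Z2_power n) \<longleftrightarrow> y \<in> extensional {1..n} \<and> (\<forall>i\<in>{1..n}. y i = 0 \<or> y i = 1)"
proof -
  have "y i \<in> {0..<2} \<longleftrightarrow> y i = 0 \<or> y i = 1" for i by auto
  then show ?thesis by (auto simp: carrier_Z2_power PiE_iff)
qed

lemma mod_2_cases: "(x :: int) mod 2 = 0 \<or> x mod 2 = 1"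
  by presburger

definition differences :: "nat \<Rightarrow> (nat \<Rightarrow> int) \<Rightarrow> (nat \<Rightarrow> int)"
  where "differences n y = (\<lambda>j\<in>{1..n}. (y j + y (succ_vertex n j)) mod 2)"

definition encode :: "nat \<Rightarrow> (nat \<Rightarrow> int) \<Rightarrow> int \<times> (nat \<Rightarrow> int)"
  where "encode n y = (y 1, differences n y)"

text \<open>Summing the differences from \<open>1\<close> telescopes to \<open>y 1 + y i\<close>, so \<open>decode\<close> recovers a state from
  \<open>encode\<close>; even weight is what makes the differences close up around the cycle.\<close>

definition decode :: "nat \<Rightarrow> int \<times> (nat \<Rightarrow> int) \<Rightarrow> (nat \<Rightarrow> int)"
  where "decode n p = (\<lambda>i\<in>{1..n}. (fst p + (\<Sum>j = 1..<i. snd p j)) mod 2)"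

lemma sum_succ_vertex:
  fixes y :: "nat \<Rightarrow> int"
  assumes "n \<ge> 1"
  shows "(\<Sum>j = 1..n. y (succ_vertex n j)) = (\<Sum>j = 1..n. y j)"
proof -
  have "bij_betw (succ_vertex n) {1..n} {1..n}"
    by (rule bij_betw_byWitness[where f' = "pred_vertex n"])
       (use assms in \<open>auto simp: succ_vertex_def pred_vertex_def\<close>)
  then show ?thesis by (rule sum.reindex_bij_betw)
qed

lemma differences_closed:
  assumes "n \<ge> 1"
  shows "differences n y \<in> carrier (perp_ones n)"
proof -
  have "even (\<Sum>j = 1..n. y j + y (succ_vertex n j))"
    by (simp add: sum.distrib sum_succ_vertex assms)
  then have "(\<Sum>j = 1..n. (y j + y (succ_vertex n j)) mod 2) mod 2 = 0"
    by (simp only: mod_sum_eq even_iff_mod_2_eq_zero)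
  then show ?thesis
    using mod_2_cases by (auto simp: perp_ones_iff differences_def)
qed

lemma encode_closed:
  assumes "n \<ge> 1" "y \<in> carrier (Z2_power n)"
  shows "encode n y \<in> {0, 1} \<times> carrier (perp_ones n)"
  using assms differences_closed by (auto simp: encode_def state_iff)

lemma decode_closed: "decode n p \<in> carrier (Z2_power n)"
  using mod_2_cases by (auto simp: state_iff decode_def)

lemma decode_encode:
  assumes "n \<ge> 1" and y: "y \<in> carrier (Z2_power n)"
  shows "decode n (encode n y) = y"
proof (rule extensionalityI[of _ "{1..n}"])
  show "y \<in> extensional {1..n}" using y by (simp add: state_iff)
  fix i assume i: "i \<in> {1..n}"
  have "(y 1 + (\<Sum>j = 1..<i. differences n y j)) mod 2 = y i"
    using i
  proof (induction i)
    case (Suc i)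
    show ?case
    proof (cases "i = 0")
      case True
      then have "y (Suc i) = 0 \<or> y (Suc i) = 1" "Suc i = 1"
        using y Suc.prems by (auto simp: state_iff)
      then show ?thesis by (auto simp: One_nat_def)
    next
      case False
      then have i: "i \<in> {1..n}" "succ_vertex n i = Suc i"
        using Suc.prems by (auto simp: succ_vertex_def)
      then have IH: "(y 1 + (\<Sum>j = 1..<i. differences n y j)) mod 2 = y i"
        using Suc.IH by blast
      have "{1..<Suc i} = insert i {1..<i}" using i by auto
      then have "(\<Sum>j = 1..<Suc i. differences n y j)
          = (\<Sum>j = 1..<i. differences n y j) + differences n y i" by simp
      moreover have "differences n y i = (y i + y (Suc i)) mod 2"
        using i by (simp add: differences_def)
      moreover have "y (Suc i) = 0 \<or> y (Suc i) = 1"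
        using y Suc.prems by (auto simp: state_iff)
      ultimately show ?thesis using IH by presburger
    qed
  qed simp
  then show "decode n (encode n y) i = y i"
    using i by (simp add: decode_def encode_def)
qed (simp add: decode_def)

lemma encode_decode:
  assumes "n \<ge> 1" and p: "p \<in> {0, 1} \<times> carrier (perp_ones n)"
  shows "encode n (decode n p) = p"
proof -
  obtain b d where bd: "p = (b, d)" "b = 0 \<or> b = 1" "d \<in> carrier (perp_ones n)"
    using p by auto
  have first: "decode n (b, d) 1 = b"
    using assms(1) bd(2) by (auto simp: decode_def)
  have "differences n (decode n (b, d)) = d"
  proof (rule extensionalityI[of _ "{1..n}"])
    show "d \<in> extensional {1..n}" using bd by (simp add: perp_ones_iff)
    fix i assume i: "i \<in> {1..n}"
    have di: "d i = 0 \<or> d i = 1" using bd i by (auto simp: perp_ones_iff)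
    show "differences n (decode n (b, d)) i = d i"
    proof (cases "i = n")
      \<comment> \<open>The difference across the edge from \<open>n\<close> back to \<open>1\<close> is the sum of all the others,
        which is \<open>d n\<close> because \<open>d\<close> has even weight.\<close>
      case True
      have "(\<Sum>j = 1..n. d j) = (\<Sum>j = 1..<n. d j) + d n"
        using assms(1) by (simp add: sum.last_plus add.commute)
      moreover have "even (\<Sum>j = 1..n. d j)" using bd by (simp add: perp_ones_iff)
      moreover have "((b + s) mod 2 + b) mod 2 = x" if "even (s + x)" "x = 0 \<or> x = 1" for s x :: int
        using that by presburger
      ultimately have "((b + (\<Sum>j = 1..<n. d j)) mod 2 + b) mod 2 = d n"
        using di True by metis
      moreover have "decode n (b, d) n = (b + (\<Sum>j = 1..<n. d j)) mod 2"
        using assms(1) by (simp add: decode_def)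
      ultimately show ?thesis
        using True i first by (simp add: differences_def succ_vertex_def)
    next
      case False
      have "{1..<i + 1} = insert i {1..<i}" using i by auto
      then have "(\<Sum>j = 1..<i + 1. d j) = (\<Sum>j = 1..<i. d j) + d i" by simp
      moreover have "((b + s) mod 2 + (b + (s + x)) mod 2) mod 2 = x" if "x = 0 \<or> x = 1" for s x :: int
        using that by presburger
      ultimately show ?thesis
        using False i di by (simp add: differences_def decode_def succ_vertex_def)
    qed
  qed (simp add: differences_def)
  then show ?thesis by (simp add: encode_def bd first)
qed

text \<open>Encoding identifies the \<open>2 ^ n\<close> states with two copies of the even-weight vectors.\<close>

lemma card_perp_ones:
  assumes "n \<ge> 1"
  shows "card (carrier (perp_ones n)) = 2 ^ (n - 1)"
proof -
  have "bij_betw (encode n) (carrier (Z2_power n)) ({0, 1} \<times> carrier (perp_ones n))"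
    using assms encode_closed decode_closed decode_encode encode_decode
    by (intro bij_betw_byWitness[where f' = "decode n"] ballI image_subsetI)
  then have "card (carrier (Z2_power n)) = 2 * card (carrier (perp_ones n))"
    using bij_betw_same_card by (fastforce simp: card_cartesian_product)
  moreover have "card (carrier (Z2_power n)) = 2 ^ n"
    by (simp add: carrier_Z2_power card_PiE)
  moreover have "(2::nat) ^ n = 2 * 2 ^ (n - 1)"
    using assms by (cases n) auto
  ultimately show ?thesis by simp
qed

section \<open>The affine action\<close>

abbreviation affine_group :: "nat \<Rightarrow> ((nat \<Rightarrow> int) \<times> (nat \<Rightarrow> nat)) monoid"
  where "affine_group n \<equiv> semidirect_product (perp_ones n) (sym_group n) (permute_coords n)"

lemma carrier_affine_group:
  "(v, \<sigma>) \<in> carrier (affine_group n) \<longleftrightarrow> v \<in> carrier (perp_ones n) \<and> \<sigma> permutes {1..n}"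
  by (simp add: semidirect_product_def sym_group_carrier)

lemma mult_affine_group:
  "(v, \<sigma>) \<otimes>\<^bsub>affine_group n\<^esub> (w, \<tau>)
    = (v \<otimes>\<^bsub>perp_ones n\<^esub> permute_coords n \<sigma> w, \<sigma> \<circ> \<tau>)"
  by (simp add: semidirect_product_def sym_group_mult)

lemma one_affine_group: "\<one>\<^bsub>affine_group n\<^esub> = (\<one>\<^bsub>perp_ones n\<^esub>, id)"
  by (simp add: semidirect_product_def sym_group_one)

lemma one_perp_ones: "\<one>\<^bsub>perp_ones n\<^esub> = (\<lambda>i\<in>{1..n}. 0)"
  by (simp add: perp_ones_def Z2_power_def)

lemma group_affine_group: "group (affine_group n)"
  using comm_group_perp_ones sym_group_is_group permute_coords_action
  by (intro group_semidirect_product) (auto simp: comm_group_def)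

definition dot :: "nat \<Rightarrow> (nat \<Rightarrow> int) \<Rightarrow> (nat \<Rightarrow> int) \<Rightarrow> int"
  where "dot n v d = (\<Sum>i = 1..n. v i * d i)"

text \<open>Acting by \<open>v\<close> after \<open>\<sigma>\<close>, that is pairing \<open>v\<close> with \<open>\<sigma> d\<close> and not with \<open>d\<close>, is what
  makes this a left action for the multiplication \<open>(v, \<sigma>) (w, \<tau>) = (v + \<sigma> w, \<sigma> \<tau>)\<close>.\<close>

definition affine_action ::
    "nat \<Rightarrow> (nat \<Rightarrow> int) \<times> (nat \<Rightarrow> nat) \<Rightarrow> int \<times> (nat \<Rightarrow> int) \<Rightarrow> int \<times> (nat \<Rightarrow> int)"
  where "affine_action n = (\<lambda>(v, \<sigma>) (b, d).
    ((b + dot n v (permute_coords n \<sigma> d)) mod 2, permute_coords n \<sigma> d))"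

lemma dot_mult_left:
  "dot n (v \<otimes>\<^bsub>perp_ones n\<^esub> w) d mod 2 = (dot n v d + dot n w d) mod 2"
proof -
  have "dot n (v \<otimes>\<^bsub>perp_ones n\<^esub> w) d mod 2 = (\<Sum>i = 1..n. (v i + w i) mod 2 * d i mod 2) mod 2"
    unfolding dot_def mod_sum_eq by (simp add: mult_perp_ones)
  also have "\<dots> = (\<Sum>i = 1..n. (v i + w i) * d i) mod 2"
    by (simp only: mod_mult_left_eq mod_sum_eq)
  finally show ?thesis
    by (simp add: dot_def sum.distrib distrib_right)
qed

lemma dot_permute_coords:
  assumes \<sigma>: "\<sigma> permutes {1..n}" and "v \<in> carrier (perp_ones n)" "d \<in> carrier (perp_ones n)"
  shows "dot n (permute_coords n \<sigma> v) (permute_coords n \<sigma> d) = dot n v d"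
  using assms sum.permute[OF permutes_inv[OF \<sigma>], of "\<lambda>i. v i * d i"]
  by (simp add: dot_def permute_coords_def o_def)

lemma affine_action_closed:
  assumes "g \<in> carrier (affine_group n)" "p \<in> {0, 1} \<times> carrier (perp_ones n)"
  shows "affine_action n g p \<in> {0, 1} \<times> carrier (perp_ones n)"
  using assms mod_2_cases
  by (cases g; cases p) (auto simp: affine_action_def carrier_affine_group permute_coords_closed)

lemma affine_action_one:
  assumes "p \<in> {0, 1} \<times> carrier (perp_ones n)"
  shows "affine_action n \<one>\<^bsub>affine_group n\<^esub> p = p"
  using assms
  by (cases p) (auto simp: affine_action_def one_affine_group permute_coords_id dot_def one_perp_ones)

text \<open>Compatibility with multiplication comes down to
  \<open>(v + \<sigma> w) \<bullet> \<sigma>\<tau>d = v \<bullet> \<sigma>\<tau>d + w \<bullet> \<tau>d\<close>, by invariance of the pairing under permutations.\<close>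

lemma affine_action_mult:
  assumes "g \<in> carrier (affine_group n)" "h \<in> carrier (affine_group n)"
    "p \<in> {0, 1} \<times> carrier (perp_ones n)"
  shows "affine_action n (g \<otimes>\<^bsub>affine_group n\<^esub> h) p = affine_action n g (affine_action n h p)"
proof -
  obtain v \<sigma> w \<tau> b d where eq: "g = (v, \<sigma>)" "h = (w, \<tau>)" "p = (b, d)"
    by (metis surj_pair)
  have \<sigma>: "\<sigma> permutes {1..n}" "\<tau> permutes {1..n}"
    and v: "v \<in> carrier (perp_ones n)" "w \<in> carrier (perp_ones n)" "d \<in> carrier (perp_ones n)"
    using assms by (auto simp: eq carrier_affine_group)
  let ?d = "permute_coords n \<tau> d"
  have "dot n (v \<otimes>\<^bsub>perp_ones n\<^esub> permute_coords n \<sigma> w) (permute_coords n \<sigma> ?d) mod 2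
      = (dot n v (permute_coords n \<sigma> ?d) + dot n w ?d) mod 2"
    using \<sigma> v by (simp add: dot_mult_left dot_permute_coords permute_coords_closed)
  then have "(b + dot n (v \<otimes>\<^bsub>perp_ones n\<^esub> permute_coords n \<sigma> w) (permute_coords n \<sigma> ?d)) mod 2
      = ((b + dot n w ?d) mod 2 + dot n v (permute_coords n \<sigma> ?d)) mod 2"
    by presburger
  then show ?thesis
    using \<sigma> v by (simp add: eq mult_affine_group affine_action_def permute_coords_compose)
qed

definition state_action ::
    "nat \<Rightarrow> (nat \<Rightarrow> int) \<times> (nat \<Rightarrow> nat) \<Rightarrow> (nat \<Rightarrow> int) \<Rightarrow> (nat \<Rightarrow> int)"
  where "state_action n g =
    (\<lambda>y \<in> carrier (Z2_power n). decode n (affine_action n g (encode n y)))"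

lemma encode_state_action:
  assumes "n \<ge> 1" "g \<in> carrier (affine_group n)" "y \<in> carrier (Z2_power n)"
  shows "encode n (state_action n g y) = affine_action n g (encode n y)"
  using assms by (simp add: state_action_def encode_decode affine_action_closed encode_closed)

lemma state_action_hom:
  assumes n: "n \<ge> 1"
  shows "group_hom (affine_group n) (BijGroup (carrier (Z2_power n))) (state_action n)"
proof -
  have "state_action n \<in> hom (affine_group n) (BijGroup (carrier (Z2_power n)))"
  proof (rule hom_BijGroupI[OF group_affine_group])
    fix g h y assume gh: "g \<in> carrier (affine_group n)" "h \<in> carrier (affine_group n)"
      and y: "y \<in> carrier (Z2_power n)"
    show "state_action n (g \<otimes>\<^bsub>affine_group n\<^esub> h) y = state_action n g (state_action n h y)"
      using n gh y affine_action_mult[OF gh encode_closed[OF n y]] encode_state_action[OF n gh(2) y]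
      by (simp add: state_action_def decode_closed)
  next
    fix y assume y: "y \<in> carrier (Z2_power n)"
    then show "state_action n \<one>\<^bsub>affine_group n\<^esub> y = y"
      using affine_action_one[OF encode_closed[OF n y]]
      by (simp add: state_action_def decode_encode n)
  qed (auto simp: state_action_def decode_closed)
  then show ?thesis
    by (simp add: group_hom_def group_hom_axioms_def group_affine_group group_BijGroup)
qed

section \<open>Generators of the affine group\<close>

definition pair_vector :: "nat \<Rightarrow> nat \<Rightarrow> nat \<Rightarrow> (nat \<Rightarrow> int)"
  where "pair_vector n i j = (\<lambda>k\<in>{1..n}. if k = i \<or> k = j then 1 else 0)"

lemma dot_commute: "dot n v w = dot n w v"
  by (simp add: dot_def mult.commute)

lemma dot_pair_vector:
  assumes "i \<in> {1..n}" "j \<in> {1..n}" "i \<noteq> j"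
  shows "dot n (pair_vector n i j) d = d i + d j"
proof -
  have "dot n (pair_vector n i j) d = (\<Sum>k\<in>{i, j}. d k)"
    unfolding dot_def using assms
    by (intro sum.mono_neutral_cong_right) (auto simp: pair_vector_def)
  then show ?thesis using assms by simp
qed

lemma pair_vector_closed:
  assumes "i \<in> {1..n}" "j \<in> {1..n}" "i \<noteq> j"
  shows "pair_vector n i j \<in> carrier (perp_ones n)"
proof -
  have "(\<Sum>k = 1..n. pair_vector n i j k) = 2"
    using dot_pair_vector[OF assms, of "\<lambda>_. 1"] by (simp add: dot_def)
  then show ?thesis by (auto simp: perp_ones_iff) (auto simp: pair_vector_def)
qed

lemma permute_coords_pair_vector:
  assumes \<sigma>: "\<sigma> permutes {1..n}" and ij: "i \<in> {1..n}" "j \<in> {1..n}" "i \<noteq> j"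
  shows "permute_coords n \<sigma> (pair_vector n i j) = pair_vector n (\<sigma> i) (\<sigma> j)"
proof -
  have "inv' \<sigma> k \<in> {1..n}" if "k \<in> {1..n}" for k
    using permutes_in_image[OF permutes_inv[OF \<sigma>]] that by blast
  moreover have "inv' \<sigma> k = l \<longleftrightarrow> k = \<sigma> l" for k l
    using permutes_inverses[OF \<sigma>] by metis
  ultimately show ?thesis
    using pair_vector_closed[OF ij]
    by (auto simp: permute_coords_def pair_vector_def intro!: restrict_ext)
qed

text \<open>The element that acts on states as the local update at \<open>i\<close>.  Only the update at vertex
  \<open>1\<close> changes \<open>y 1\<close>, the first component of \<open>encode\<close>, hence the case distinction.\<close>

definition rule150_element :: "nat \<Rightarrow> nat \<Rightarrow> (nat \<Rightarrow> int) \<times> (nat \<Rightarrow> nat)"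
  where "rule150_element n i =
    (if i = 1 then pair_vector n 1 n else \<one>\<^bsub>perp_ones n\<^esub>, transpose (pred_vertex n i) i)"

lemma one_perp_ones_closed: "\<one>\<^bsub>perp_ones n\<^esub> \<in> carrier (perp_ones n)"
  using comm_group_perp_ones[of n] by (simp add: comm_group_def group.is_monoid monoid.one_closed)

lemma pred_vertex_props:
  assumes "n > 2" "i \<in> {1..n}"
  shows "pred_vertex n i \<in> {1..n}" "pred_vertex n i \<noteq> i" "succ_vertex n (pred_vertex n i) = i"
    "succ_vertex n i \<in> {1..n}" "succ_vertex n i \<noteq> i" "pred_vertex n i \<noteq> succ_vertex n i"
    "\<And>j. j \<in> {1..n} \<Longrightarrow> succ_vertex n j = i \<longleftrightarrow> j = pred_vertex n i"
  using assms by (auto simp: pred_vertex_def succ_vertex_def)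

lemma rule150_element_closed:
  assumes "n > 2" "i \<in> {1..n}"
  shows "rule150_element n i \<in> carrier (affine_group n)"
  using assms pred_vertex_props[OF assms] one_perp_ones_closed pair_vector_closed[of 1 n n]
  by (auto simp: rule150_element_def carrier_affine_group intro!: permutes_swap_id)

text \<open>The update adds \<open>y\<^sub>i\<^sub>-\<^sub>1 + y\<^sub>i\<^sub>+\<^sub>1 = d\<^sub>i\<^sub>-\<^sub>1 + d\<^sub>i\<close> to the two differences that involve \<open>y\<^sub>i\<close>,
  and adding \<open>a + b\<close> to both \<open>a\<close> and \<open>b\<close> modulo \<open>2\<close> exchanges them.\<close>

lemma differences_rule150_update:
  assumes n: "n > 2" and i: "i \<in> {1..n}" and y: "y \<in> carrier (Z2_power n)"
  shows "differences n (rule150_update n i y)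
    = permute_coords n (transpose (pred_vertex n i) i) (differences n y)"
proof -
  note p = pred_vertex_props[OF n i]
  have d: "differences n y \<in> carrier (perp_ones n)"
    using n by (intro differences_closed) simp
  have inv: "inv' (transpose (pred_vertex n i) i) = transpose (pred_vertex n i) i"
    by (simp add: inv_transpose_eq)
  have tr: "transpose (pred_vertex n i) i j \<in> {1..n}" if "j \<in> {1..n}" for j
    using that p(1) i by (auto simp: transpose_def)
  have parity: "((a + b + c) mod 2 + c) mod 2 = (a + b) mod 2"
    "(a + (a + b + c) mod 2) mod 2 = (b + c) mod 2" for a b c :: int
    by presburger+
  have "differences n (rule150_update n i y) j
      = differences n y (transpose (pred_vertex n i) i j)" if j: "j \<in> {1..n}" for j
  proof -
    consider "j = i" | "j = pred_vertex n i" | "j \<noteq> i" "j \<noteq> pred_vertex n i" by blast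
    then show ?thesis
    proof cases
      case 1
      then show ?thesis
        using p(1-6) i y by (simp add: differences_def rule150_update_def parity)
    next
      case 2
      then show ?thesis
        using p(1-6) i y by (simp add: differences_def rule150_update_def parity)
    next
      case 3
      then show ?thesis
        using p(7)[OF j] j y by (simp add: differences_def rule150_update_def)
    qed
  qed
  then show ?thesis
    using d tr by (auto simp: permute_coords_def inv differences_def intro!: restrict_ext)
qed

lemma state_action_rule150_element:
  assumes n: "n > 2" and i: "i \<in> {1..n}"
  shows "state_action n (rule150_element n i) = rule150_update n i"
proof (rule extensionalityI[of _ "carrier (Z2_power n)"])
  fix y assume y: "y \<in> carrier (Z2_power n)"
  let ?d = "permute_coords n (transpose (pred_vertex n i) i) (differences n y)"
  have d: "differences n y \<in> carrier (perp_ones n)"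
    using n by (intro differences_closed) simp
  have "rule150_update n i y 1 = (y 1 + dot n (fst (rule150_element n i)) ?d) mod 2"
  proof (cases "i = 1")
    case True
    have "?d 1 = differences n y n" "?d n = differences n y 1"
      using n d by (simp_all add: True permute_coords_def pred_vertex_def inv_transpose_eq)
    moreover have "dot n (pair_vector n 1 n) ?d = ?d 1 + ?d n"
      using n by (intro dot_pair_vector) auto
    ultimately have "dot n (fst (rule150_element n i)) ?d = differences n y n + differences n y 1"
      by (simp add: rule150_element_def True)
    then show ?thesis
      using n y True
      by (simp add: differences_def rule150_update_def succ_vertex_def pred_vertex_def) presburger
  next
    case False
    have "y 1 = 0 \<or> y 1 = 1" using n y by (auto simp: state_iff)
    then have "y 1 mod 2 = y 1" by auto
    then show ?thesis
      using False y by (simp add: rule150_element_def dot_def one_perp_ones rule150_update_def)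
  qed
  then have "affine_action n (rule150_element n i) (encode n y) = encode n (rule150_update n i y)"
    using differences_rule150_update[OF n i y]
    by (simp add: affine_action_def encode_def rule150_element_def split: prod.split)
  then show "state_action n (rule150_element n i) y = rule150_update n i y"
    using n y rule150_update_closed[OF i y] by (simp add: state_action_def decode_encode)
qed (auto simp: state_action_def rule150_update_def)

text \<open>The elements of the vertices \<open>2, \<dots>, n\<close> are the adjacent transpositions, so the symmetric
  group is already generated without the update at \<open>1\<close>.\<close>

lemma affine_subgroup_contains_permutations:
  assumes T: "subgroup T (affine_group n)"
    and gens: "\<And>i. i \<in> {1..n} \<Longrightarrow> rule150_element n i \<in> T"
    and \<sigma>: "\<sigma> permutes {1..n}"
  shows "(\<one>\<^bsub>perp_ones n\<^esub>, \<sigma>) \<in> T"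
proof -
  interpret P: comm_group "perp_ones n" by (rule comm_group_perp_ones)
  have comp: "(\<one>\<^bsub>perp_ones n\<^esub>, \<tau> \<circ> \<rho>) \<in> T"
    if "(\<one>\<^bsub>perp_ones n\<^esub>, \<tau>) \<in> T" "(\<one>\<^bsub>perp_ones n\<^esub>, \<rho>) \<in> T" for \<tau> \<rho>
  proof -
    have "\<tau> permutes {1..n}"
      using that subgroup.mem_carrier[OF T] by (auto simp: carrier_affine_group)
    then have "permute_coords n \<tau> \<one>\<^bsub>perp_ones n\<^esub> = \<one>\<^bsub>perp_ones n\<^esub>"
      using hom_one[OF permute_coords_hom] P.is_group by blast
    then show ?thesis
      using subgroup.m_closed[OF T that] by (simp add: mult_affine_group)
  qed
  have id: "(\<one>\<^bsub>perp_ones n\<^esub>, id) \<in> T"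
    using subgroup.one_closed[OF T] by (simp add: one_affine_group)
  have adj: "(\<one>\<^bsub>perp_ones n\<^esub>, apply_adj_transps xs) \<in> T" if "set xs \<subseteq> {1..<n}" for xs
    using that
  proof (induction xs)
    case (Cons x xs)
    have "rule150_element n (x + 1) \<in> T"
      using Cons.prems by (intro gens) auto
    then have "(\<one>\<^bsub>perp_ones n\<^esub>, transpose x (x + 1)) \<in> T"
      using Cons.prems by (simp add: rule150_element_def pred_vertex_def)
    then have "(\<one>\<^bsub>perp_ones n\<^esub>, transpose x (x + 1) \<circ> apply_adj_transps xs) \<in> T"
      using Cons by (intro comp) auto
    then show ?case by (simp only: apply_adj_transps_Cons)
  qed (simp add: id)
  have less: "(\<one>\<^bsub>perp_ones n\<^esub>, transpose a b) \<in> T" if "a \<in> {1..n}" "b \<in> {1..n}" "a < b" for a b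
    using adj[of "adj_transp_seq a b"] that by (auto simp: adj_transp_seq_correct set_adj_transp_seq)
  have transp: "(\<one>\<^bsub>perp_ones n\<^esub>, transpose a b) \<in> T" if "a \<in> {1..n}" "b \<in> {1..n}" "a \<noteq> b" for a b
    using less[of a b] less[of b a] that by (cases "a < b") (auto simp: transpose_commute)
  show ?thesis
    using \<sigma> finite_atLeastAtMost
  proof (induction rule: permutes_induct)
    case (swap a b \<rho>)
    then show ?case by (intro comp transp)
  qed (rule id)
qed

text \<open>Cancelling the transposition in the element of vertex \<open>1\<close> leaves the translation by
  \<open>e\<^sub>1 + e\<^sub>n\<close>; conjugating it by \<open>\<sigma>\<close> yields the translation by \<open>e\<^sub>\<sigma>\<^sub>1 + e\<^sub>\<sigma>\<^sub>n\<close>.\<close>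

lemma affine_subgroup_contains_pairs:
  assumes T: "subgroup T (affine_group n)" and n: "n > 2"
    and gens: "\<And>i. i \<in> {1..n} \<Longrightarrow> rule150_element n i \<in> T"
    and ij: "i \<in> {1..n}" "j \<in> {1..n}" "i \<noteq> j"
  shows "(pair_vector n i j, id) \<in> T"
proof -
  interpret P: comm_group "perp_ones n" by (rule comm_group_perp_ones)
  have perm: "(\<one>\<^bsub>perp_ones n\<^esub>, \<tau>) \<in> T" if "\<tau> permutes {1..n}" for \<tau>
    using T gens that by (rule affine_subgroup_contains_permutations)
  have one: "permute_coords n \<tau> \<one>\<^bsub>perp_ones n\<^esub> = \<one>\<^bsub>perp_ones n\<^esub>" if "\<tau> permutes {1..n}" for \<tau>
    using hom_one[OF permute_coords_hom[OF that]] P.is_group by blast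
  have pair: "pair_vector n 1 n \<in> carrier (perp_ones n)"
    using n by (intro pair_vector_closed) auto
  have sw: "transpose n 1 permutes {1..n}"
    using n by (intro permutes_swap_id) auto
  have "rule150_element n 1 \<otimes>\<^bsub>affine_group n\<^esub> (\<one>\<^bsub>perp_ones n\<^esub>, transpose n 1) \<in> T"
    using n sw by (intro subgroup.m_closed[OF T] gens perm) auto
  then have base: "(pair_vector n 1 n, id) \<in> T"
    using sw pair by (simp add: rule150_element_def pred_vertex_def mult_affine_group one)
  \<comment> \<open>A permutation with \<open>1 \<mapsto> i\<close> and \<open>n \<mapsto> j\<close>: first \<open>1\<close> goes to \<open>l \<noteq> n\<close>, which the second
    transposition takes to \<open>i\<close> while it takes \<open>n\<close> to \<open>j\<close>.\<close>
  define l where "l = transpose n j i"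
  define \<sigma> where "\<sigma> = transpose n j \<circ> transpose 1 l"
  have l: "l \<in> {1..n}" "l \<noteq> n"
    using ij n by (auto simp: l_def transpose_def)
  have \<sigma>: "\<sigma> permutes {1..n}"
    unfolding \<sigma>_def using l ij n by (intro permutes_compose permutes_swap_id) auto
  have "\<sigma> 1 = i" "\<sigma> n = j"
    using l n by (auto simp: \<sigma>_def l_def transpose_def split: if_splits)
  then have img: "permute_coords n \<sigma> (pair_vector n 1 n) = pair_vector n i j"
    using permute_coords_pair_vector[OF \<sigma>, of 1 n] n by auto
  have "(\<one>\<^bsub>perp_ones n\<^esub>, \<sigma>) \<otimes>\<^bsub>affine_group n\<^esub> (pair_vector n 1 n, id)
      \<otimes>\<^bsub>affine_group n\<^esub> (\<one>\<^bsub>perp_ones n\<^esub>, inv' \<sigma>) \<in> T"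
    by (intro subgroup.m_closed[OF T] perm base \<sigma> permutes_inv)
  then show ?thesis
    using \<sigma> pair_vector_closed[OF ij]
    by (simp add: mult_affine_group img one permutes_inv permutes_inv_o)
qed

text \<open>A nonzero vector of even weight has two distinct entries \<open>1\<close>; adding \<open>e\<^sub>i + e\<^sub>j\<close> there
  makes the support smaller.\<close>

lemma perp_ones_pair_induct [consumes 1, case_names one pair]:
  assumes v: "v \<in> carrier (perp_ones n)"
    and one: "Q \<one>\<^bsub>perp_ones n\<^esub>"
    and pair: "\<And>i j w. i \<in> {1..n} \<Longrightarrow> j \<in> {1..n} \<Longrightarrow> i \<noteq> j \<Longrightarrow> w \<in> carrier (perp_ones n) \<Longrightarrow> Q w \<Longrightarrow>
                 Q (pair_vector n i j \<otimes>\<^bsub>perp_ones n\<^esub> w)"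
  shows "Q v"
  using v
proof (induction "card {k \<in> {1..n}. v k = 1}" arbitrary: v rule: less_induct)
  case less
  interpret P: comm_group "perp_ones n" by (rule comm_group_perp_ones)
  let ?supp = "\<lambda>v :: nat \<Rightarrow> int. {k \<in> {1..n}. v k = 1}"
  have v01: "v k = 0 \<or> v k = 1" if "k \<in> {1..n}" for k
    using less.prems that by (simp add: perp_ones_iff)
  have "(\<Sum>k = 1..n. v k) = (\<Sum>k\<in>?supp v. 1)"
    by (intro sum.mono_neutral_cong_right) (auto dest: v01)
  then have even: "even (card (?supp v))"
    using less.prems by (simp add: perp_ones_iff)
  show ?case
  proof (cases "?supp v = {}")
    case True
    then have "v = \<one>\<^bsub>perp_ones n\<^esub>"
      using v01 less.prems unfolding one_perp_ones
      by (intro extensionalityI[of _ "{1..n}"]) (auto simp: perp_ones_iff)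
    then show ?thesis using one by simp
  next
    case False
    then obtain i where i: "i \<in> ?supp v" by blast
    have "?supp v \<noteq> {i}" using even by force
    then obtain j where j: "j \<in> ?supp v" "i \<noteq> j" using i by blast
    let ?e = "pair_vector n i j"
    have e: "?e \<in> carrier (perp_ones n)"
      using i j by (intro pair_vector_closed) auto
    have "?supp (?e \<otimes>\<^bsub>perp_ones n\<^esub> v) \<subset> ?supp v"
    proof -
      have "i \<notin> ?supp (?e \<otimes>\<^bsub>perp_ones n\<^esub> v)"
        using i by (simp add: mult_perp_ones pair_vector_def)
      moreover have "k \<in> ?supp v" if "k \<in> ?supp (?e \<otimes>\<^bsub>perp_ones n\<^esub> v)" for k
      proof (cases "k = i \<or> k = j")
        case False
        with that v01[of k] show ?thesis by (auto simp: mult_perp_ones pair_vector_def)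
      qed (use i j in auto)
      ultimately show ?thesis using i by blast
    qed
    then have "card (?supp (?e \<otimes>\<^bsub>perp_ones n\<^esub> v)) < card (?supp v)"
      by (intro psubset_card_mono) auto
    then have Q: "Q (?e \<otimes>\<^bsub>perp_ones n\<^esub> v)"
      using less.hyps e less.prems by blast
    have "?e \<otimes>\<^bsub>perp_ones n\<^esub> ?e = \<one>\<^bsub>perp_ones n\<^esub>"
      by (auto simp: mult_perp_ones pair_vector_def one_perp_ones intro!: restrict_ext)
    then have "?e \<otimes>\<^bsub>perp_ones n\<^esub> (?e \<otimes>\<^bsub>perp_ones n\<^esub> v) = v"
      using e less.prems by (simp flip: P.m_assoc)
    then show ?thesis
      using pair[OF _ _ j(2) _ Q] i j(1) e less.prems by simp
  qed
qed

lemma generate_rule150_elements: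
  assumes n: "n > 2"
  shows "generate (affine_group n) (rule150_element n ` {1..n}) = carrier (affine_group n)"
proof -
  interpret A: group "affine_group n" by (rule group_affine_group)
  interpret P: comm_group "perp_ones n" by (rule comm_group_perp_ones)
  let ?T = "generate (affine_group n) (rule150_element n ` {1..n})"
  have sub: "rule150_element n ` {1..n} \<subseteq> carrier (affine_group n)"
    using rule150_element_closed[OF n] by blast
  have T: "subgroup ?T (affine_group n)"
    using sub by (rule A.generate_is_subgroup)
  have gens: "rule150_element n i \<in> ?T" if "i \<in> {1..n}" for i
    using that by (blast intro: generate.incl)
  have perm: "(\<one>\<^bsub>perp_ones n\<^esub>, \<tau>) \<in> ?T" if "\<tau> permutes {1..n}" for \<tau>
    using T gens that by (rule affine_subgroup_contains_permutations)
  have trans: "(v, id) \<in> ?T" if "v \<in> carrier (perp_ones n)" for v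
    using that
  proof (induction rule: perp_ones_pair_induct)
    case one
    show ?case by (rule perm[OF permutes_id])
  next
    case (pair i j w)
    have "(pair_vector n i j, id) \<otimes>\<^bsub>affine_group n\<^esub> (w, id) \<in> ?T"
      by (intro subgroup.m_closed[OF T] pair affine_subgroup_contains_pairs[OF T n gens])
    then show ?case
      using pair by (simp only: mult_affine_group permute_coords_id id_comp)
  qed
  have "p \<in> ?T" if mem: "p \<in> carrier (affine_group n)" for p
  proof -
    obtain v \<sigma> where p: "p = (v, \<sigma>)" "v \<in> carrier (perp_ones n)" "\<sigma> permutes {1..n}"
      using mem by (cases p) (auto simp: carrier_affine_group)
    have "(v, id) \<otimes>\<^bsub>affine_group n\<^esub> (\<one>\<^bsub>perp_ones n\<^esub>, \<sigma>) \<in> ?T"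
      using p by (intro subgroup.m_closed[OF T] trans perm)
    then show ?thesis using p by (simp add: mult_affine_group permute_coords_id)
  qed
  then show ?thesis using A.generate_incl[OF sub] by blast
qed

lemma state_action_onto_G150:
  assumes n: "n > 3"
  shows "group_hom (affine_group n) (G150 n) (state_action n)"
    and "state_action n ` carrier (affine_group n) = carrier (G150 n)"
proof -
  interpret h: group_hom "affine_group n" "BijGroup (carrier (Z2_power n))" "state_action n"
    using n by (intro state_action_hom) simp
  have "state_action n ` rule150_element n ` {1..n} = rule150_update n ` {1..n}"
    using n state_action_rule150_element by (force simp: image_image)
  moreover have "rule150_element n ` {1..n} \<subseteq> carrier (affine_group n)"
    using n rule150_element_closed by auto
  ultimately show img: "state_action n ` carrier (affine_group n) = carrier (G150 n)"
    using h.generate_img[of "rule150_element n ` {1..n}"] generate_rule150_elements[of n] n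
    by (simp add: G150_def)
  have "state_action n \<in> hom (affine_group n) (G150 n)"
    using h.homh img by (auto simp: hom_def G150_def)
  then show "group_hom (affine_group n) (G150 n) (state_action n)"
    using n by (simp add: group_hom_def group_hom_axioms_def group_affine_group group_G150)
qed

section \<open>The kernel\<close>

lemma state_action_eq_one_iff:
  fixes n :: nat
  assumes n: "n \<ge> 1" and g: "g \<in> carrier (affine_group n)"
  shows "state_action n g = \<one>\<^bsub>BijGroup (carrier (Z2_power n))\<^esub> \<longleftrightarrow>
    (\<forall>p \<in> {0, 1} \<times> carrier (perp_ones n). affine_action n g p = p)" (is "_ \<longleftrightarrow> ?R")
proof
  assume id: "state_action n g = \<one>\<^bsub>BijGroup (carrier (Z2_power n))\<^esub>"
  show ?R
  proof
    fix p :: "int \<times> (nat \<Rightarrow> int)"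
    assume p: "p \<in> {0, 1} \<times> carrier (perp_ones n)"
    have "state_action n g (decode n p) = decode n p"
      by (simp add: id BijGroup_def decode_closed)
    then show "affine_action n g p = p"
      using encode_state_action[OF n g decode_closed, of p] encode_decode[OF n p] by simp
  qed
next
  assume ?R
  then show "state_action n g = \<one>\<^bsub>BijGroup (carrier (Z2_power n))\<^esub>"
    using encode_closed[OF n] decode_encode[OF n]
    unfolding state_action_def BijGroup_def monoid.simps by (intro restrict_ext) metis
qed

text \<open>If \<open>\<sigma>\<close> moved \<open>i\<close>, a third index \<open>j\<close> would give a pair \<open>{i, j}\<close> whose image contains
  \<open>\<sigma> i\<close> and so differs from it.\<close>

lemma permutation_eq_id_of_fixed_pairs:
  assumes n: "n > 2" and \<sigma>: "\<sigma> permutes {1..n}"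
    and fixed: "\<And>i j. i \<in> {1..n} \<Longrightarrow> j \<in> {1..n} \<Longrightarrow> i \<noteq> j \<Longrightarrow>
                  permute_coords n \<sigma> (pair_vector n i j) = pair_vector n i j"
  shows "\<sigma> = id"
proof (rule ccontr)
  assume "\<sigma> \<noteq> id"
  then obtain i where i: "\<sigma> i \<noteq> i" by fastforce
  then have in_n: "i \<in> {1..n}" "\<sigma> i \<in> {1..n}"
    using \<sigma> permutes_in_image[OF \<sigma>] by (auto simp: permutes_def)
  have "card {i, \<sigma> i} < card {1..n}" using n i by simp
  then obtain j where j: "j \<in> {1..n}" "j \<noteq> i" "j \<noteq> \<sigma> i"
    by (metis card_mono finite.emptyI finite.insertI insert_iff linorder_not_less subsetI)
  have "pair_vector n (\<sigma> i) (\<sigma> j) = pair_vector n i j"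
    using fixed[of i j] permute_coords_pair_vector[OF \<sigma>, of i j] in_n j by simp
  then have "pair_vector n (\<sigma> i) (\<sigma> j) (\<sigma> i) = pair_vector n i j (\<sigma> i)" by simp
  then show False
    using in_n i j by (simp add: pair_vector_def split: if_splits)
qed

lemma constant_perp_ones_iff:
  assumes n: "n \<ge> 1" and v: "v \<in> carrier (perp_ones n)"
  shows "(\<forall>i\<in>{1..n}. \<forall>j\<in>{1..n}. v i = v j) \<longleftrightarrow> v = \<one>\<^bsub>perp_ones n\<^esub> \<or> v = all_ones n"
proof
  assume const: "\<forall>i\<in>{1..n}. \<forall>j\<in>{1..n}. v i = v j"
  have v1: "v 1 = 0 \<or> v 1 = 1" using n v by (auto simp: perp_ones_iff)
  have "v = (\<lambda>i\<in>{1..n}. v 1)"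
  proof (rule extensionalityI[of _ "{1..n}"])
    fix i assume i: "i \<in> {1..n}"
    moreover have "1 \<in> {1..n}" using n by simp
    ultimately have "v i = v 1" using const by blast
    then show "v i = (\<lambda>i\<in>{1..n}. v 1) i" using i by simp
  qed (use v in \<open>simp_all add: perp_ones_iff\<close>)
  then show "v = \<one>\<^bsub>perp_ones n\<^esub> \<or> v = all_ones n"
    using v1 by (metis all_ones_def one_perp_ones)
qed (auto simp: one_perp_ones all_ones_def)

text \<open>Acting trivially on pairs \<open>(b, d)\<close> means that \<open>\<sigma>\<close> fixes every \<open>d\<close> and \<open>v\<close> is orthogonal to
  every \<open>d\<close>.  Testing with \<open>d = e\<^sub>i + e\<^sub>j\<close> shows \<open>\<sigma> = id\<close> and that \<open>v\<close> is constant; the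
  converse holds as every \<open>d\<close> has even weight.  For odd \<open>n\<close> the membership condition
  excludes the all-ones vector.\<close>

lemma kernel_state_action:
  assumes n: "n > 3"
  shows "kernel (affine_group n) (G150 n) (state_action n) =
    {(v, id) | v. v \<in> carrier (perp_ones n) \<and> (v = \<one>\<^bsub>perp_ones n\<^esub> \<or> v = all_ones n)}"
proof -
  have "state_action n (v, \<sigma>) = \<one>\<^bsub>G150 n\<^esub> \<longleftrightarrow> \<sigma> = id \<and> (v = \<one>\<^bsub>perp_ones n\<^esub> \<or> v = all_ones n)"
    if v: "v \<in> carrier (perp_ones n)" and \<sigma>: "\<sigma> permutes {1..n}" for v \<sigma>
  proof -
    have g: "(v, \<sigma>) \<in> carrier (affine_group n)"
      using v \<sigma> by (simp add: carrier_affine_group)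
    have "state_action n (v, \<sigma>) = \<one>\<^bsub>G150 n\<^esub> \<longleftrightarrow>
        (\<forall>p \<in> {0, 1} \<times> carrier (perp_ones n). affine_action n (v, \<sigma>) p = p)"
      using state_action_eq_one_iff[OF _ g] n by (simp add: G150_def)
    also have "\<dots> \<longleftrightarrow> \<sigma> = id \<and> (\<forall>d \<in> carrier (perp_ones n). even (dot n v d))"
    proof
      assume fixed: "\<forall>p \<in> {0, 1} \<times> carrier (perp_ones n). affine_action n (v, \<sigma>) p = p"
      have d: "permute_coords n \<sigma> d = d \<and> even (dot n v d)" if "d \<in> carrier (perp_ones n)" for d
        using bspec[OF fixed, of "(0, d)"] that by (auto simp: affine_action_def)
      have "\<sigma> = id"
        using n \<sigma> d pair_vector_closed by (intro permutation_eq_id_of_fixed_pairs) auto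
      with d show "\<sigma> = id \<and> (\<forall>d \<in> carrier (perp_ones n). even (dot n v d))" by blast
    next
      assume R: "\<sigma> = id \<and> (\<forall>d \<in> carrier (perp_ones n). even (dot n v d))"
      show "\<forall>p \<in> {0, 1} \<times> carrier (perp_ones n). affine_action n (v, \<sigma>) p = p"
      proof
        fix p :: "int \<times> (nat \<Rightarrow> int)"
        assume "p \<in> {0, 1} \<times> carrier (perp_ones n)"
        then obtain b d where p: "p = (b, d)" "b = 0 \<or> b = 1" "d \<in> carrier (perp_ones n)" by blast
        then have d: "permute_coords n \<sigma> d = d" and "even (dot n v d)"
          using R permute_coords_id by simp_all
        then have "(b + dot n v d) mod 2 = b" using p(2) by presburger
        then show "affine_action n (v, \<sigma>) p = p"
          by (simp add: p(1) d affine_action_def)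
      qed
    qed
    also have "(\<forall>d \<in> carrier (perp_ones n). even (dot n v d)) \<longleftrightarrow>
        (\<forall>i\<in>{1..n}. \<forall>j\<in>{1..n}. v i = v j)"
    proof
      assume ev: "\<forall>d \<in> carrier (perp_ones n). even (dot n v d)"
      have "v i = v j" if "i \<in> {1..n}" "j \<in> {1..n}" "i \<noteq> j" for i j
      proof -
        have "even (v i + v j)"
          using ev pair_vector_closed[OF that] dot_pair_vector[OF that, of v]
          by (metis dot_commute)
        moreover have "v i = 0 \<or> v i = 1" "v j = 0 \<or> v j = 1"
          using v that by (auto simp: perp_ones_iff)
        ultimately show ?thesis by auto
      qed
      then show "\<forall>i\<in>{1..n}. \<forall>j\<in>{1..n}. v i = v j" by metis
    next
      assume const: "\<forall>i\<in>{1..n}. \<forall>j\<in>{1..n}. v i = v j"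
      have "v i * d i = v 1 * d i" if "i \<in> {1..n}" for i d
      proof -
        have "1 \<in> {1..n}" using n by simp
        then have "v i = v 1" using const that by blast
        then show ?thesis by simp
      qed
      then have "dot n v d = v 1 * (\<Sum>i = 1..n. d i)" for d
        unfolding dot_def sum_distrib_left by (rule sum.cong[OF refl])
      then show "\<forall>d \<in> carrier (perp_ones n). even (dot n v d)"
        by (simp add: perp_ones_iff)
    qed
    also have "\<dots> \<longleftrightarrow> v = \<one>\<^bsub>perp_ones n\<^esub> \<or> v = all_ones n"
      using n v by (intro constant_perp_ones_iff) auto
    finally show ?thesis .
  qed
  then show ?thesis
    by (auto simp: kernel_def carrier_affine_group permutes_id)
qed

section \<open>Cycles of odd and of even length\<close>

abbreviation affine_group_quot :: "nat \<Rightarrow> ((nat \<Rightarrow> int) set \<times> (nat \<Rightarrow> nat)) monoid"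
  where "affine_group_quot n \<equiv>
    semidirect_product (perp_ones_quot n) (sym_group n) (permute_coords_quot n)"

lemma generate_all_ones:
  assumes "even n"
  shows "generate (perp_ones n) {all_ones n} = {\<one>\<^bsub>perp_ones n\<^esub>, all_ones n}"
proof -
  interpret P: comm_group "perp_ones n" by (rule comm_group_perp_ones)
  have ones: "all_ones n \<in> carrier (perp_ones n)" using assms by (rule all_ones_in_perp_ones)
  have sq: "all_ones n \<otimes>\<^bsub>perp_ones n\<^esub> all_ones n = \<one>\<^bsub>perp_ones n\<^esub>"
    by (auto simp: mult_perp_ones one_perp_ones all_ones_def intro!: restrict_ext)
  then have "inv\<^bsub>perp_ones n\<^esub> (all_ones n) = all_ones n"
    using ones by (simp add: P.inv_equality)
  then have "subgroup {\<one>\<^bsub>perp_ones n\<^esub>, all_ones n} (perp_ones n)"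
    using ones sq by (intro P.subgroupI) auto
  then have "generate (perp_ones n) {all_ones n} \<subseteq> {\<one>\<^bsub>perp_ones n\<^esub>, all_ones n}"
    by (intro P.generate_subgroup_incl) auto
  then show ?thesis by (auto intro: generate.incl generate.one)
qed

lemma card_perp_ones_quot:
  assumes n: "n \<ge> 2" "even n"
  shows "card (carrier (perp_ones_quot n)) = 2 ^ (n - 2)"
proof -
  interpret P: comm_group "perp_ones n" by (rule comm_group_perp_ones)
  let ?K = "generate (perp_ones n) {all_ones n}"
  have "all_ones n 1 \<noteq> \<one>\<^bsub>perp_ones n\<^esub> 1"
    using n by (simp add: all_ones_def one_perp_ones)
  then have "card ?K = 2"
    using n by (auto simp: generate_all_ones card_insert_if)
  moreover have "subgroup ?K (perp_ones n)"
    using normal_generate_all_ones[OF n(2)] by (rule normal_imp_subgroup)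
  ultimately have "card (carrier (perp_ones_quot n)) * 2 = 2 ^ (n - 1)"
    using P.lagrange[of ?K] card_perp_ones[of n] n
    by (simp add: perp_ones_quot_def FactGroup_def order_def)
  moreover have "(2::nat) ^ (n - 1) = 2 ^ (n - 2) * 2"
    using n by (metis Suc_1 Suc_diff_Suc Suc_le_lessD power_Suc2 diff_Suc_Suc One_nat_def)
  ultimately show ?thesis by simp
qed

definition affine_proj ::
    "nat \<Rightarrow> (nat \<Rightarrow> int) \<times> (nat \<Rightarrow> nat) \<Rightarrow> (nat \<Rightarrow> int) set \<times> (nat \<Rightarrow> nat)"
  where "affine_proj n = (\<lambda>(v, \<sigma>).
    (generate (perp_ones n) {all_ones n} #>\<^bsub>perp_ones n\<^esub> v, \<sigma>))"

text \<open>The kernel is written as in \<open>kernel_state_action\<close>, ready for \<open>iso_of_equal_kernels\<close>.\<close>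

lemma affine_proj_onto:
  assumes n: "even n"
  shows "group_hom (affine_group n) (affine_group_quot n) (affine_proj n)"
    and "affine_proj n ` carrier (affine_group n) = carrier (affine_group_quot n)"
    and "kernel (affine_group n) (affine_group_quot n) (affine_proj n) =
      {(v, id) | v. v \<in> carrier (perp_ones n) \<and> (v = \<one>\<^bsub>perp_ones n\<^esub> \<or> v = all_ones n)}"
proof -
  interpret P: comm_group "perp_ones n" by (rule comm_group_perp_ones)
  let ?K = "generate (perp_ones n) {all_ones n}"
  interpret K: normal ?K "perp_ones n" using n by (rule normal_generate_all_ones)
  have quot: "group (perp_ones_quot n)"
    unfolding perp_ones_quot_def by (rule K.factorgroup_is_group)
  have carrier: "carrier (perp_ones_quot n) = (\<lambda>v. ?K #>\<^bsub>perp_ones n\<^esub> v) ` carrier (perp_ones n)"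
    by (auto simp: perp_ones_quot_def carrier_FactGroup)
  show img: "affine_proj n ` carrier (affine_group n) = carrier (affine_group_quot n)"
    by (force simp: affine_proj_def semidirect_product_def carrier)
  have "affine_proj n (g \<otimes>\<^bsub>affine_group n\<^esub> h)
      = affine_proj n g \<otimes>\<^bsub>affine_group_quot n\<^esub> affine_proj n h"
    if "g \<in> carrier (affine_group n)" "h \<in> carrier (affine_group n)" for g h
  proof -
    obtain v \<sigma> w \<tau> where eq: "g = (v, \<sigma>)" "h = (w, \<tau>)" by (metis surj_pair)
    have \<sigma>: "\<sigma> permutes {1..n}"
      and v: "v \<in> carrier (perp_ones n)" "w \<in> carrier (perp_ones n)"
      using that by (auto simp: eq carrier_affine_group)
    have "permute_coords_quot n \<sigma> (?K #>\<^bsub>perp_ones n\<^esub> w) = ?K #>\<^bsub>perp_ones n\<^esub> permute_coords n \<sigma> w"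
      using v(2) by (simp add: permute_coords_quot_def carrier permute_coords_image_rcoset[OF n \<sigma>])
    then show ?thesis
      using \<sigma> v by (simp add: eq affine_proj_def mult_affine_group semidirect_product_def
          sym_group_mult perp_ones_quot_def K.rcos_sum permute_coords_closed)
  qed
  then have "affine_proj n \<in> hom (affine_group n) (affine_group_quot n)"
    using img by (auto simp: hom_def)
  moreover have "group (affine_group_quot n)"
    by (rule group_semidirect_product[OF quot sym_group_is_group permute_coords_quot_action[OF n]])
  ultimately show "group_hom (affine_group n) (affine_group_quot n) (affine_proj n)"
    by (simp add: group_hom_def group_hom_axioms_def group_affine_group)
  have "?K #>\<^bsub>perp_ones n\<^esub> v = ?K \<longleftrightarrow> v = \<one>\<^bsub>perp_ones n\<^esub> \<or> v = all_ones n"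
    if "v \<in> carrier (perp_ones n)" for v
  proof -
    have "?K #>\<^bsub>perp_ones n\<^esub> v = ?K \<longleftrightarrow> v \<in> ?K"
      using that P.coset_join1[OF _ that K.subgroup_axioms] P.coset_join2[OF that K.subgroup_axioms]
        K.subset by blast
    then show ?thesis by (simp add: generate_all_ones n)
  qed
  then show "kernel (affine_group n) (affine_group_quot n) (affine_proj n) =
      {(v, id) | v. v \<in> carrier (perp_ones n) \<and> (v = \<one>\<^bsub>perp_ones n\<^esub> \<or> v = all_ones n)}"
    by (auto simp: kernel_def affine_proj_def semidirect_product_def sym_group_carrier
        sym_group_one perp_ones_quot_def permutes_id)
qed

lemma G150_iso_odd:
  assumes n: "n > 3" "odd n"
  shows "G150 n \<cong> affine_group n"
proof -
  interpret A: group "affine_group n" by (rule group_affine_group)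
  have "all_ones n \<notin> carrier (perp_ones n)"
    using n by (simp add: perp_ones_iff all_ones_def)
  then have "kernel (affine_group n) (G150 n) (state_action n) = {\<one>\<^bsub>affine_group n\<^esub>}"
    using one_perp_ones_closed by (auto simp: kernel_state_action[OF n(1)] one_affine_group)
  moreover have "kernel (affine_group n) (affine_group n) id = {\<one>\<^bsub>affine_group n\<^esub>}"
    by (auto simp: kernel_def)
  moreover have "group_hom (affine_group n) (affine_group n) id"
    by unfold_locales (auto simp: hom_def)
  ultimately show ?thesis
    using state_action_onto_G150[OF n(1)] by (intro iso_of_equal_kernels) auto
qed

lemma G150_iso_even:
  assumes n: "n > 3" "even n"
  shows "G150 n \<cong> affine_group_quot n"
  using state_action_onto_G150[OF n(1)] affine_proj_onto[OF n(2)] kernel_state_action[OF n(1)]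
  by (intro iso_of_equal_kernels) auto

lemma order_semidirect_product:
  "order (semidirect_product N H \<phi>) = order N * order H"
  by (simp add: order_def semidirect_product_def card_cartesian_product)

theorem theorem5p4:
  fixes n :: nat
  assumes "n > 3"
  shows "(odd n \<longrightarrow>
            G150 n \<cong> semidirect_product (perp_ones n) (sym_group n) (permute_coords n)) \<and>
         (even n \<longrightarrow>
            G150 n \<cong> semidirect_product (perp_ones_quot n) (sym_group n) (permute_coords_quot n)) \<and>
         (odd n \<longrightarrow> order (G150 n) = 2 ^ (n - 1) * fact n) \<and>
         (even n \<longrightarrow> order (G150 n) = 2 ^ (n - 2) * fact n)"
proof -
  have sym: "order (sym_group n) = fact n"
    by (simp add: order_def sym_group_card_carrier)
  have "order (G150 n) = 2 ^ (n - 1) * fact n" if "odd n"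
    using iso_same_card[OF G150_iso_odd[OF assms that]] card_perp_ones[of n] assms sym
    by (simp add: order_semidirect_product flip: order_def)
  moreover have "order (G150 n) = 2 ^ (n - 2) * fact n" if "even n"
    using iso_same_card[OF G150_iso_even[OF assms that]] card_perp_ones_quot[of n] that assms sym
    by (simp add: order_semidirect_product flip: order_def)
  ultimately show ?thesis
    using G150_iso_odd G150_iso_even assms by blast
qed

end
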